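(* Let $C\subset\mathbb{R}^n$ and $Q\subset\mathbb{R}^m$ be nonempty closed convex sets, and let the set-valued map $S_1:\mathbb{R}^{m\times n}\rightrightarrows\mathbb{R}^n$ be defined by $$S_1(A):=\{x\in C\,:\,Ax\in Q\},\qquad A\in\mathbb{R}^{m\times n}.$$ Let $\bar A\in\mathbb{R}^{m\times n}$ and $\bar x\in S_1(\bar A)$. Consider the condition $$(\ast)\qquad (\bar A^{\mathrm T})^{-1}\big(-N(\bar x;C)\big)\cap N(\bar A\bar x;Q)=\{0\}.$$ If $(\ast)$ holds, then $S_1$ is Lipschitz-like at $(\bar A,\bar x)$. Conversely, if $S_1$ is Lipschitz-like at $(\bar A,\bar x)$ and if $\bar x\neq 0$, then $(\ast)$ holds.
   Context: $S_1$ is the solution map of the split feasibility problem (find $x\in C$ with $Ax\in Q$); the sets $C,Q$ are fixed and the matrix $A$ is perturbed. For a convex set $\Omega\subset\mathbb{R}^p$ and $\bar x\in\Omega$, the normal cone is $N(\bar x;\Omega)=\{x'\in\mathbb{R}^p : \langle x',x-\bar x\rangle\le 0\ \ \forall x\in\Omega\}$ (for convex sets the limiting normal cone coincides with this one). For a matrix $M\in\mathbb{R}^{q\times p}$, $M^{\mathrm T}$ is its transpose, and for $\Omega\subset\mathbb{R}^q$, $M^{-1}(\Omega)=\{x\in\mathbb{R}^p : Mx\in\Omega\}$ denotes the preimage ($M$ need not be invertible). Thus $(\bar A^{\mathrm T})^{-1}(-N(\bar x;C))=\{z\in\mathbb{R}^m : \bar A^{\mathrm T}z\in -N(\bar x;C)\}$.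 A set-valued map $\Phi:X\rightrightarrows Y$ between normed spaces is Lipschitz-like (pseudo-Lipschitz, has the Aubin property) at $(\bar p,\bar q)$ with $\bar q\in\Phi(\bar p)$ if there exist neighborhoods $U$ of $\bar p$ and $V$ of $\bar q$ and a constant $\ell>0$ such that $\Phi(p')\cap V\subset\Phi(p)+\ell\|p'-p\|\,\overline{\mathbb{B}}_Y$ for all $p,p'\in U$, where $\overline{\mathbb{B}}_Y$ is the closed unit ball of $Y$. *)

theory Defs
  imports "HOL-Analysis.Analysis"
begin

text \<open>Normal cone of convex analysis. It is meant for convex \<open>\<Omega>\<close> and \<open>x \<in> \<Omega>\<close>;
  for \<open>x \<notin> \<Omega>\<close> no convention (such as the empty set) is imposed.\<close>

definition normal_cone :: "'a::real_inner \<Rightarrow> 'a set \<Rightarrow> 'a set" where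
  "normal_cone x \<Omega> = {x'. \<forall>y\<in>\<Omega>. x' \<bullet> (y - x) \<le> 0}"

definition lipschitz_like ::
    "('a::real_normed_vector \<Rightarrow> 'b::real_normed_vector set) \<Rightarrow> 'a \<Rightarrow> 'b \<Rightarrow> bool" where
  "lipschitz_like \<Phi> p\<^sub>0 q\<^sub>0 \<longleftrightarrow>
     q\<^sub>0 \<in> \<Phi> p\<^sub>0 \<and>
     (\<exists>U V. \<exists>l::real. open U \<and> p\<^sub>0 \<in> U \<and> open V \<and> q\<^sub>0 \<in> V \<and> l > 0 \<and>
        (\<forall>p\<in>U. \<forall>p'\<in>U.
           \<Phi> p' \<inter> V \<subseteq> {q + (l * norm (p' - p)) *\<^sub>R b |q b. q \<in> \<Phi> p \<and> b \<in> cball 0 1}))"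

text \<open>Matrices \<open>real ^ 'n ^ 'm\<close> have \<open>'m\<close> rows and \<open>'n\<close> columns, and their library norm
  is the Frobenius norm. In finite dimensions all norms are equivalent, so this choice affects
  only the constant in \<^const>\<open>lipschitz_like\<close>.\<close>

definition split_feasibility_sol ::
    "(real ^ 'n) set \<Rightarrow> (real ^ 'm) set \<Rightarrow> real ^ 'n ^ 'm \<Rightarrow> (real ^ 'n) set" where
  "split_feasibility_sol C Q A = {x \<in> C. A *v x \<in> Q}"

end

theory Submission
  imports Defs
begin

text \<open>
  A vector \<open>z\<close> belongs to the set in the qualification condition exactly when
  \<open>z \<bullet> (A *v c - q) \<ge> 0\<close> for all \<open>c \<in> C\<close> and \<open>q \<in> Q\<close>
  (lemma \<open>qualification_iff_separates\<close>).  The condition therefore says that no nonzero vector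
  separates the origin from the convex set \<open>A C - Q\<close>, which contains the origin.

  \<^emph>\<open>Sufficiency.\<close>  If no such vector exists, then the origin is interior to \<open>A C - Q\<close>, and
  this persists quantitatively: one radius \<open>r\<close> works for all matrices near \<open>A\<close> and with \<open>C\<close>
  truncated to a fixed ball (lemma \<open>uniform_regularity\<close>).  Both uniformities come from one
  compactness argument on unit separating vectors.  Now let \<open>u\<close> be feasible for a matrix \<open>B'\<close>
  and let \<open>B\<close> be another matrix, both near \<open>A\<close>.  The residual \<open>(B - B') *v u\<close> of \<open>u\<close> in the
  system of \<open>B\<close> is of order \<open>norm (B - B')\<close>.  As in Robinson's stability theorem
  for convex systems, choose \<open>k \<in> C\<close> and \<open>q \<in> Q\<close> such that \<open>B *v k - q\<close> has length \<open>r\<close> and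
  points against the residual.  A convex combination of \<open>u\<close> and \<open>k\<close>, with weight on \<open>k\<close>
  at most the length of the residual divided by \<open>r\<close>, is then exactly feasible (lemma \<open>robinson_error_bound\<close>).

  \<^emph>\<open>Necessity.\<close>  If a nonzero \<open>z\<close> separates, tilt \<open>A\<close> in the direction of the rank-one matrix
  with entries \<open>z $ i * x $ j\<close>.  For every \<open>c\<close> in the open half-space \<open>x \<bullet> c > 0\<close> this makes
  \<open>z \<bullet> (A *v c - q)\<close> strictly positive, so the tilted problem has no solution there.  If
  \<open>x \<noteq> 0\<close>, the half-space is a neighbourhood of \<open>x\<close>, and the Lipschitz-like property,
  which requires solutions near \<open>x\<close>, fails.
\<close>

section \<open>Normal cones and separation\<close>

text \<open>Taking \<open>q = A *v x\<close>, respectively \<open>c = x\<close>, in the separation inequality gives the two normal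
  cone memberships; conversely their defining inequalities add up to it.\<close>

lemma qualification_iff_separates:
  fixes A :: "real ^ 'n ^ 'm"
  assumes "x \<in> C" and "A *v x \<in> Q"
  shows "z \<in> (*v) (transpose A) -` (uminus ` normal_cone x C) \<inter> normal_cone (A *v x) Q
    \<longleftrightarrow> (\<forall>c\<in>C. \<forall>q\<in>Q. 0 \<le> z \<bullet> (A *v c - q))"
    (is "?L \<longleftrightarrow> ?R")
proof -
  have adj: "(transpose A *v z) \<bullet> (c - x) = z \<bullet> (A *v c) - z \<bullet> (A *v x)" for c
    by (simp add: dot_lmul_matrix matrix_vector_mult_diff_distrib inner_diff_right
        del: vector_transpose_matrix)
  have "w \<in> uminus ` normal_cone x C \<longleftrightarrow> - w \<in> normal_cone x C" for w
    by (metis image_iff minus_minus)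
  then have "?L \<longleftrightarrow> (\<forall>c\<in>C. 0 \<le> (transpose A *v z) \<bullet> (c - x)) \<and> (\<forall>q\<in>Q. z \<bullet> (q - A *v x) \<le> 0)"
    by (simp add: normal_cone_def del: transpose_matrix_vector)
  also have "\<dots> \<longleftrightarrow> (\<forall>c\<in>C. z \<bullet> (A *v x) \<le> z \<bullet> (A *v c)) \<and> (\<forall>q\<in>Q. z \<bullet> q \<le> z \<bullet> (A *v x))"
    unfolding adj by (simp add: inner_diff_right)
  also have "\<dots> \<longleftrightarrow> ?R"
    using assms by (fastforce simp: inner_diff_right)
  finally show ?thesis .
qed

section \<open>Uniform metric regularity\<close>

lemma norm_matrix_vector_mult_le:
  fixes B :: "real ^ 'n ^ 'm"
  shows "norm (B *v v) \<le> norm B * norm v"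
proof -
  have "norm (B *v v) \<le> L2_set (\<lambda>i. norm (B $ i) * norm v) UNIV"
    unfolding norm_vec_def[of "B *v v"]
    by (rule L2_set_mono) (auto simp: matrix_vector_mul_component Cauchy_Schwarz_ineq2)
  also have "\<dots> = norm B * norm v"
    by (simp add: norm_vec_def[of B] L2_set_left_distrib)
  finally show ?thesis .
qed

text \<open>The truncation makes the image of \<open>C\<close> compact, so that the difference with \<open>Q\<close> is closed
  and can be separated from each outside point.\<close>

lemma separate_from_truncated_difference:
  fixes B :: "real ^ 'n ^ 'm"
  assumes "closed C" "convex C" "closed Q" "convex Q" "x \<in> C" "Q \<noteq> {}" "0 \<le> R"
    and d: "d \<notin> {B *v c - q |c q. c \<in> C \<inter> cball x R \<and> q \<in> Q}"
  shows "\<exists>z. norm z = 1 \<and> (\<forall>c \<in> C \<inter> cball x R. \<forall>q\<in>Q. z \<bullet> d \<le> z \<bullet> (B *v c - q))"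
proof -
  let ?K = "(*v) B ` (C \<inter> cball x R)"
  let ?D = "\<Union>y\<in>?K. \<Union>q\<in>Q. {y - q}"
  have "compact ?K"
    using assms by (intro compact_continuous_image closed_Int_compact compact_cball
        linear_continuous_on matrix_vector_mul_bounded_linear)
  then have "closed ?D"
    using assms by (intro compact_closed_differences)
  moreover have "convex ?D"
    using assms by (intro convex_differences convex_linear_image convex_Int convex_cball) auto
  moreover have "d \<notin> ?D"
    using d by auto
  ultimately obtain a b where ab: "a \<bullet> d < b" "\<And>y. y \<in> ?D \<Longrightarrow> b < a \<bullet> y"
    using separating_hyperplane_closed_point by metis
  obtain q0 where "q0 \<in> Q"
    using assms by auto
  then have "B *v x - q0 \<in> ?D"
    using assms by auto
  with ab have "a \<noteq> 0"
    by force
  have "sgn a \<bullet> d \<le> sgn a \<bullet> (B *v c - q)" if "c \<in> C \<inter> cball x R" "q \<in> Q" for c q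
  proof -
    have "a \<bullet> d \<le> a \<bullet> (B *v c - q)"
      using ab(1) ab(2)[of "B *v c - q"] that by force
    then show ?thesis
      by (simp add: sgn_div_norm divide_right_mono mult_left_mono)
  qed
  with \<open>a \<noteq> 0\<close> show ?thesis
    by (intro exI[of _ "sgn a"]) (auto simp: norm_sgn)
qed

text \<open>If the conclusion failed for \<open>r = 1, 1/2, 1/3, \<dots>\<close>, there would be matrices tending to \<open>A\<close>,
  points tending to \<open>0\<close> outside the corresponding truncated differences, and unit vectors
  separating the two.  A cluster point of these unit vectors separates \<open>0\<close> from all of
  \<open>A C - Q\<close>, because the truncation radii tend to infinity.\<close>

lemma uniform_regularity:
  fixes A :: "real ^ 'n ^ 'm"
  assumes C: "closed C" "convex C" and Q: "closed Q" "convex Q" "Q \<noteq> {}" and "x \<in> C"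
    and nosep: "\<And>z. (\<forall>c\<in>C. \<forall>q\<in>Q. 0 \<le> z \<bullet> (A *v c - q)) \<Longrightarrow> z = 0"
  shows "\<exists>r>0. \<forall>B. norm (B - A) < r \<longrightarrow>
    cball 0 r \<subseteq> {B *v c - q |c q. c \<in> C \<inter> cball x (1 / r) \<and> q \<in> Q}"
proof (rule ccontr)
  assume neg: "\<not> ?thesis"
  define e where "e k = inverse (real (Suc k))" for k
  have epos: "0 < e k" for k
    by (simp add: e_def)
  have e0: "e \<longlonglongrightarrow> 0"
    unfolding e_def by (rule LIMSEQ_inverse_real_of_nat)
  have "\<exists>B d z. norm (B - A) < e k \<and> norm d \<le> e k \<and> norm z = 1 \<and>
      (\<forall>c \<in> C \<inter> cball x (1 / e k). \<forall>q\<in>Q. z \<bullet> d \<le> z \<bullet> (B *v c - q))" for k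
  proof -
    obtain B d where B: "norm (B - A) < e k" and d: "d \<in> cball 0 (e k)"
      "d \<notin> {B *v c - q |c q. c \<in> C \<inter> cball x (1 / e k) \<and> q \<in> Q}"
      using neg epos[of k] by blast
    have "0 \<le> 1 / e k"
      using epos[of k] by simp
    from separate_from_truncated_difference[OF C Q(1,2) \<open>x \<in> C\<close> Q(3) this d(2)] B d(1)
    show ?thesis
      by auto
  qed
  then obtain B d z where B: "\<And>k. norm (B k - A) < e k" and d: "\<And>k. norm (d k) \<le> e k"
    and z: "\<And>k. norm (z k) = 1"
    and sep: "\<And>k c q. c \<in> C \<inter> cball x (1 / e k) \<Longrightarrow> q \<in> Q \<Longrightarrow> z k \<bullet> d k \<le> z k \<bullet> (B k *v c - q)"
    by metis
  have "compact (sphere (0 :: real ^ 'm) 1)" and "\<forall>k. z k \<in> sphere 0 1"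
    using z by auto
  then obtain w \<phi> where w: "w \<in> sphere 0 1" and \<phi>: "strict_mono \<phi>" and lim: "(z \<circ> \<phi>) \<longlonglongrightarrow> w"
    unfolding compact_def by metis
  have d0: "d \<longlonglongrightarrow> 0"
    using d e0 by (intro Lim_null_comparison[of d e]) auto
  have Bc: "(\<lambda>k. B k *v c) \<longlonglongrightarrow> A *v c" for c
  proof -
    have "norm (B k *v c - A *v c) \<le> e k * norm c" for k
    proof -
      have "norm (B k *v c - A *v c) \<le> norm (B k - A) * norm c"
        using norm_matrix_vector_mult_le[of "B k - A" c]
        by (simp add: matrix_vector_mult_diff_rdistrib)
      also have "\<dots> \<le> e k * norm c"
        using B[of k] by (intro mult_right_mono) auto
      finally show ?thesis .
    qed
    then have "(\<lambda>k. B k *v c - A *v c) \<longlonglongrightarrow> 0"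
      by (intro Lim_null_comparison[OF _ tendsto_mult_left_zero[OF e0, of "norm c"]]) auto
    then show ?thesis
      by (simp add: LIM_zero_iff)
  qed
  have "0 \<le> w \<bullet> (A *v c - q)" if "c \<in> C" "q \<in> Q" for c q
  proof -
    have low: "(\<lambda>k. z (\<phi> k) \<bullet> d (\<phi> k)) \<longlonglongrightarrow> w \<bullet> 0"
      using lim LIMSEQ_subseq_LIMSEQ[OF d0 \<phi>] by (intro tendsto_inner) (auto simp: o_def)
    have up: "(\<lambda>k. z (\<phi> k) \<bullet> (B (\<phi> k) *v c - q)) \<longlonglongrightarrow> w \<bullet> (A *v c - q)"
      using lim LIMSEQ_subseq_LIMSEQ[OF Bc \<phi>]
      by (intro tendsto_inner tendsto_diff) (auto simp: o_def)
    have le: "\<forall>\<^sub>F k in sequentially. z (\<phi> k) \<bullet> d (\<phi> k) \<le> z (\<phi> k) \<bullet> (B (\<phi> k) *v c - q)"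
    proof -
      obtain N :: nat where N: "dist x c \<le> real N"
        using real_arch_simple by blast
      have "c \<in> C \<inter> cball x (1 / e (\<phi> k))" if "N \<le> k" for k
      proof -
        have "real N \<le> real (\<phi> k)"
          using that strict_mono_imp_increasing[OF \<phi>, of k] by simp
        then have "dist x c \<le> real (Suc (\<phi> k))"
          using N by simp
        then show ?thesis
          using \<open>c \<in> C\<close> by (simp add: e_def inverse_eq_divide)
      qed
      then show ?thesis
        using sep \<open>q \<in> Q\<close> by (intro eventually_sequentiallyI[of N]) blast
    qed
    show ?thesis
      using tendsto_le[OF trivial_limit_sequentially up low le] by simp
  qed
  then have "w = 0"
    by (intro nosep ballI)
  with w show False
    by simp
qed

section \<open>Lipschitz-like behaviour\<close>

text \<open>An error bound for the convex system \<open>c \<in> C\<close>, \<open>B *v c \<in> Q\<close> in terms of the residual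
  \<open>B *v u - q\<^sub>0\<close>.  The weight \<open>t\<close> below is the one for which the residual of \<open>u\<close> and the opposite
  vector of length \<open>r\<close> cancel in the convex combination.\<close>

lemma robinson_error_bound:
  fixes B :: "real ^ 'n ^ 'm"
  assumes "convex C" "convex Q" "0 < r" "u \<in> C" "q\<^sub>0 \<in> Q"
    and ball: "cball 0 r \<subseteq> {B *v c - q |c q. c \<in> C \<inter> cball x R \<and> q \<in> Q}"
  shows "\<exists>c \<in> split_feasibility_sol C Q B.
    norm (u - c) \<le> norm (B *v u - q\<^sub>0) / r * (norm (u - x) + R)"
proof (cases "B *v u = q\<^sub>0")
  case True
  with assms show ?thesis
    by (intro bexI[of _ u]) (auto simp: split_feasibility_sol_def)
next
  case False
  define e where "e = B *v u - q\<^sub>0"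
  define n where "n = norm e"
  have n: "0 < n"
    using False by (simp add: n_def e_def)
  have "- (r / n) *\<^sub>R e \<in> cball 0 r"
    using n \<open>0 < r\<close> by (simp add: n_def)
  with ball obtain k q where "k \<in> C \<inter> cball x R" and q: "q \<in> Q"
    and eq: "- (r / n) *\<^sub>R e = B *v k - q"
    by blast
  then have k: "k \<in> C" "norm (k - x) \<le> R"
    by (auto simp: dist_norm norm_minus_commute)
  define t where "t = n / (r + n)"
  have t: "0 \<le> t" "t \<le> 1" "1 - t = t * (r / n)" "t \<le> n / r"
    using n \<open>0 < r\<close> by (auto simp: t_def field_simps)
  define c where "c = (1 - t) *\<^sub>R u + t *\<^sub>R k"
  have "c \<in> C"
    unfolding c_def using assms k t by (intro convexD_alt) auto
  have "B *v c = (1 - t) *\<^sub>R (q\<^sub>0 + e) + t *\<^sub>R (q - (r / n) *\<^sub>R e)"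
    using eq by (simp add: c_def e_def matrix_vector_right_distrib matrix_vector_mult_scaleR
        algebra_simps)
  also have "\<dots> = (1 - t) *\<^sub>R q\<^sub>0 + t *\<^sub>R q + ((1 - t) - t * (r / n)) *\<^sub>R e"
    by (simp add: algebra_simps)
  also have "\<dots> = (1 - t) *\<^sub>R q\<^sub>0 + t *\<^sub>R q"
    using t(3) by simp
  finally have "B *v c \<in> Q"
    using convexD_alt[OF \<open>convex Q\<close> \<open>q\<^sub>0 \<in> Q\<close> q t(1,2)] by simp
  have "norm (u - c) = t * norm (u - k)"
  proof -
    have "u - c = t *\<^sub>R (u - k)"
      by (simp add: c_def algebra_simps)
    then show ?thesis
      using t by simp
  qed
  also have "\<dots> \<le> n / r * (norm (u - x) + R)"
  proof (rule mult_mono)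
    show "norm (u - k) \<le> norm (u - x) + R"
      using norm_triangle_ineq4[of "u - x" "k - x"] k by simp
  qed (use t n \<open>0 < r\<close> in auto)
  finally show ?thesis
    using \<open>c \<in> C\<close> \<open>B *v c \<in> Q\<close> by (auto simp: split_feasibility_sol_def n_def e_def)
qed

lemma mem_scaled_ball_enlargement_iff:
  fixes v :: "'a::real_normed_vector"
  assumes "0 \<le> s"
  shows "v \<in> {q + s *\<^sub>R b |q b. q \<in> X \<and> b \<in> cball 0 1} \<longleftrightarrow> (\<exists>q\<in>X. norm (v - q) \<le> s)"
proof
  assume "v \<in> {q + s *\<^sub>R b |q b. q \<in> X \<and> b \<in> cball 0 1}"
  then obtain q b where "q \<in> X" "norm b \<le> 1" "v = q + s *\<^sub>R b"
    by auto
  then show "\<exists>q\<in>X. norm (v - q) \<le> s"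
    using assms by (auto intro!: bexI[of _ q] mult_left_le)
next
  assume "\<exists>q\<in>X. norm (v - q) \<le> s"
  then obtain q where q: "q \<in> X" "norm (v - q) \<le> s"
    by auto
  \<comment> \<open>For \<open>s = 0\<close> the inverse is \<open>0\<close>, and the formula still holds since \<open>v = q\<close>.\<close>
  have "v = q + s *\<^sub>R (inverse s *\<^sub>R (v - q))" and "norm (inverse s *\<^sub>R (v - q)) \<le> 1"
    using q assms by (cases "s = 0"; simp add: divide_inverse_commute[symmetric])+
  with q show "v \<in> {q + s *\<^sub>R b |q b. q \<in> X \<and> b \<in> cball 0 1}"
    unfolding mem_Collect_eq mem_cball_0 by blast
qed

lemma lipschitz_like_iff:
  "lipschitz_like \<Phi> p\<^sub>0 q\<^sub>0 \<longleftrightarrow>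
     q\<^sub>0 \<in> \<Phi> p\<^sub>0 \<and>
     (\<exists>U V. \<exists>l::real. open U \<and> p\<^sub>0 \<in> U \<and> open V \<and> q\<^sub>0 \<in> V \<and> l > 0 \<and>
        (\<forall>p\<in>U. \<forall>p'\<in>U. \<forall>v\<in>\<Phi> p' \<inter> V. \<exists>q\<in>\<Phi> p. norm (v - q) \<le> l * norm (p' - p)))"
proof -
  have "\<Phi> p' \<inter> V \<subseteq> {q + (l * norm (p' - p)) *\<^sub>R b |q b. q \<in> \<Phi> p \<and> b \<in> cball 0 1}
      \<longleftrightarrow> (\<forall>v\<in>\<Phi> p' \<inter> V. \<exists>q\<in>\<Phi> p. norm (v - q) \<le> l * norm (p' - p))"
    if "l > 0" for l :: real and p p' V
    using that unfolding subset_iff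
    by (subst mem_scaled_ball_enlargement_iff) auto
  then show ?thesis
    unfolding lipschitz_like_def by (simp cong: conj_cong)
qed

lemma lipschitz_like_if_no_separation:
  fixes A :: "real ^ 'n ^ 'm"
  assumes C: "closed C" "convex C" and Q: "closed Q" "convex Q"
    and x: "x \<in> split_feasibility_sol C Q A"
    and nosep: "\<And>z. (\<forall>c\<in>C. \<forall>q\<in>Q. 0 \<le> z \<bullet> (A *v c - q)) \<Longrightarrow> z = 0"
  shows "lipschitz_like (split_feasibility_sol C Q) A x"
proof -
  have "x \<in> C" "Q \<noteq> {}"
    using x by (auto simp: split_feasibility_sol_def)
  then obtain r where r: "0 < r" and reg: "\<And>B. norm (B - A) < r \<Longrightarrow>
      cball 0 r \<subseteq> {B *v c - q |c q. c \<in> C \<inter> cball x (1 / r) \<and> q \<in> Q}"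
    using uniform_regularity[OF C Q _ _ nosep] by blast
  define l where "l = (norm x + 1) / r * (1 + 1 / r)"
  have l: "0 < l"
    using r by (simp add: l_def add_nonneg_pos add_pos_pos)
  have "\<exists>c \<in> split_feasibility_sol C Q B. norm (u - c) \<le> l * norm (B' - B)"
    if B: "B \<in> ball A r" and u: "u \<in> split_feasibility_sol C Q B' \<inter> ball x 1" for B B' u
  proof -
    have u: "u \<in> C" "B' *v u \<in> Q" "norm (u - x) \<le> 1"
      using u by (auto simp: split_feasibility_sol_def dist_norm norm_minus_commute)
    have "norm (B - A) < r"
      using B by (simp add: dist_norm norm_minus_commute)
    from robinson_error_bound[OF C(2) Q(2) r u(1,2) reg[OF this]]
    obtain c where c: "c \<in> split_feasibility_sol C Q B"
      "norm (u - c) \<le> norm (B *v u - B' *v u) / r * (norm (u - x) + 1 / r)"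
      by blast
    have "norm u \<le> norm x + 1"
      using norm_triangle_ineq2[of u x] u by simp
    then have "norm (B *v u - B' *v u) \<le> norm (B' - B) * (norm x + 1)"
      using norm_matrix_vector_mult_le[of "B - B'" u]
        mult_left_mono[of "norm u" "norm x + 1" "norm (B - B')"]
      by (simp add: matrix_vector_mult_diff_rdistrib norm_minus_commute)
    then have "norm (B *v u - B' *v u) / r * (norm (u - x) + 1 / r)
        \<le> (norm (B' - B) * (norm x + 1)) / r * (1 + 1 / r)"
      using r u by (intro mult_mono divide_right_mono) auto
    also have "\<dots> = l * norm (B' - B)"
      by (simp add: l_def)
    finally show ?thesis
      using c by force
  qed
  then have unif: "\<forall>B \<in> ball A r. \<forall>B' \<in> ball A r. \<forall>u \<in> split_feasibility_sol C Q B' \<inter> ball x 1.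
      \<exists>c \<in> split_feasibility_sol C Q B. norm (u - c) \<le> l * norm (B' - B)"
    by blast
  have centres: "A \<in> ball A r" "x \<in> ball x 1"
    using r by simp_all
  show ?thesis
    unfolding lipschitz_like_iff
    by (rule conjI[OF x], rule exI[of _ "ball A r"], rule exI[of _ "ball x 1"], rule exI[of _ l])
      (intro conjI open_ball centres l unif)
qed

text \<open>The rank-one tilt moves \<open>A *v c\<close> by \<open>(t * (x \<bullet> c)) *\<^sub>R z\<close>, that is, away from \<open>Q\<close> whenever
  \<open>x \<bullet> c > 0\<close>.\<close>

lemma no_separation_if_lipschitz_like:
  fixes A :: "real ^ 'n ^ 'm"
  assumes lip: "lipschitz_like (split_feasibility_sol C Q) A x" and "x \<noteq> 0"
    and sep: "\<forall>c\<in>C. \<forall>q\<in>Q. 0 \<le> z \<bullet> (A *v c - q)"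
  shows "z = 0"
proof (rule ccontr)
  assume "z \<noteq> 0"
  from lip obtain U V and l :: real where x: "x \<in> split_feasibility_sol C Q A"
    and U: "open U" "A \<in> U" and "x \<in> V" and l: "0 < l"
    and near: "\<forall>p\<in>U. \<forall>p'\<in>U. \<forall>v \<in> split_feasibility_sol C Q p' \<inter> V.
      \<exists>q\<in>split_feasibility_sol C Q p. norm (v - q) \<le> l * norm (p' - p)"
    unfolding lipschitz_like_iff by (elim conjE exE)
  obtain \<delta> where \<delta>: "0 < \<delta>" "ball A \<delta> \<subseteq> U"
    using U openE by blast
  define W :: "real ^ 'n ^ 'm" where "W = (\<chi> i j. z $ i * x $ j)"
  have W: "W *v c = (x \<bullet> c) *\<^sub>R z" for c
    by (simp add: W_def vec_eq_iff matrix_vector_mult_def inner_vec_def sum_distrib_left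
        mult_ac)
  \<comment> \<open>A tilt shorter than \<open>m\<close> stays in \<open>U\<close>, and the solution of the tilted problem that the
    Lipschitz estimate yields is closer to \<open>x\<close> than the origin, hence lies in the half-space.\<close>
  define m where "m = min \<delta> (norm x / l)"
  have "0 < m"
    using \<delta> l \<open>x \<noteq> 0\<close> by (simp add: m_def)
  define t where "t = m / (1 + norm W)"
  have "0 < t"
    using \<open>0 < m\<close> by (simp add: t_def add_pos_nonneg)
  have "1 + norm W \<noteq> 0"
    using norm_ge_zero[of W] by linarith
  then have "t * (1 + norm W) = m"
    by (simp add: t_def)
  then have "norm (t *\<^sub>R W) < m"
    using \<open>0 < t\<close> by (simp add: distrib_left)
  then have "norm (t *\<^sub>R W) < \<delta>" and "norm (t *\<^sub>R W) < norm x / l"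
    unfolding m_def by linarith+
  then have small: "norm (t *\<^sub>R W) < \<delta>" "l * norm (t *\<^sub>R W) < norm x"
    using l by (simp_all add: pos_less_divide_eq mult.commute)
  have "A + t *\<^sub>R W \<in> U"
    using \<delta> small by (auto simp: dist_norm)
  then have "\<exists>c \<in> split_feasibility_sol C Q (A + t *\<^sub>R W).
      norm (x - c) \<le> l * norm (A - (A + t *\<^sub>R W))"
    using near U(2) x \<open>x \<in> V\<close> by blast
  then obtain c where
    c: "c \<in> split_feasibility_sol C Q (A + t *\<^sub>R W)" and "norm (x - c) \<le> l * norm (t *\<^sub>R W)"
    by auto
  then have "norm (x - c) < norm x"
    using small by linarith
  then have "norm x * norm (x - c) < norm x * norm x"
    using \<open>x \<noteq> 0\<close> by simp
  moreover have "x \<bullet> (x - c) \<le> norm x * norm (x - c)"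
    by (rule norm_cauchy_schwarz)
  ultimately have "0 < x \<bullet> c"
    by (simp add: inner_diff_right dot_square_norm power2_eq_square)
  have "c \<in> C" and "(A + t *\<^sub>R W) *v c \<in> Q"
    using c by (auto simp: split_feasibility_sol_def)
  moreover have "(A + t *\<^sub>R W) *v c = A *v c + (t * (x \<bullet> c)) *\<^sub>R z"
    by (simp add: matrix_vector_mult_add_rdistrib scaleR_matrix_vector_assoc[symmetric] W)
  ultimately have "0 \<le> z \<bullet> (A *v c - (A *v c + (t * (x \<bullet> c)) *\<^sub>R z))"
    using sep by metis
  then have "t * (x \<bullet> c) * (z \<bullet> z) \<le> 0"
    by (simp add: inner_diff_right inner_add_right)
  moreover have "0 < t * (x \<bullet> c) * (z \<bullet> z)"
    using \<open>0 < t\<close> \<open>0 < x \<bullet> c\<close> \<open>z \<noteq> 0\<close> by simp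
  ultimately show False
    by simp
qed

theorem theorem4p1:
  fixes C :: "(real ^ 'n) set" and Q :: "(real ^ 'm) set"
    and A :: "real ^ 'n ^ 'm" and x :: "real ^ 'n"
  assumes "C \<noteq> {}" and "closed C" and "convex C"
    and "Q \<noteq> {}" and "closed Q" and "convex Q"
    and "x \<in> split_feasibility_sol C Q A"
  shows "((*v) (transpose A) -` (uminus ` normal_cone x C) \<inter> normal_cone (A *v x) Q = {0}
            \<longrightarrow> lipschitz_like (split_feasibility_sol C Q) A x)
       \<and> (lipschitz_like (split_feasibility_sol C Q) A x \<and> x \<noteq> 0
            \<longrightarrow> (*v) (transpose A) -` (uminus ` normal_cone x C) \<inter> normal_cone (A *v x) Q = {0})"
proof -
  have "x \<in> C" "A *v x \<in> Q"
    using assms(7) by (auto simp: split_feasibility_sol_def)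
  note sep_iff = qualification_iff_separates[OF this]
  have cond_iff: "(*v) (transpose A) -` (uminus ` normal_cone x C) \<inter> normal_cone (A *v x) Q = {0}
      \<longleftrightarrow> (\<forall>z. (\<forall>c\<in>C. \<forall>q\<in>Q. 0 \<le> z \<bullet> (A *v c - q)) \<longrightarrow> z = 0)"
    (is "_ \<longleftrightarrow> ?nosep")
  proof -
    have "(\<forall>z. (\<forall>c\<in>C. \<forall>q\<in>Q. 0 \<le> z \<bullet> (A *v c - q)) \<longleftrightarrow> z \<in> {0}) \<longleftrightarrow> ?nosep"
      by (metis inner_zero_left order_refl singleton_iff)
    then show ?thesis
      unfolding set_eq_iff sep_iff .
  qed
  show ?thesis
    unfolding cond_iff
  proof (intro conjI impI)
    assume nosep: ?nosep
    show "lipschitz_like (split_feasibility_sol C Q) A x"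
      by (rule lipschitz_like_if_no_separation[OF assms(2,3,5,6,7)]) (use nosep in blast)
  next
    assume "lipschitz_like (split_feasibility_sol C Q) A x \<and> x \<noteq> 0"
    then show ?nosep
      by (intro allI impI, elim conjE) (rule no_separation_if_lipschitz_like)
  qed
qed

end
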